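(* Let $\mathbb F$ be a field of characteristic $p=2$ and let $\lambda=(\lambda_1,\lambda_2)\in\mathbb F^2$ with $\lambda\ne 0$. Then $\dim H^2_*(\mathfrak m_0^\lambda(2))=1$. If $\lambda_2\ne 0$, then the cohomology class of the cocycle $(0,\overline e^1)$ is a basis for $H^2_*(\mathfrak m_0^\lambda(2))$. If $\lambda_2=0$, then the cohomology class of the cocycle $(0,\overline e^2)$ is a basis for $H^2_*(\mathfrak m_0^\lambda(2))$.
   Context: Let $\mathbb F$ be a field of characteristic $2$. $\mathfrak g=\mathfrak m_0^\lambda(2)$ is the $2$-dimensional abelian Lie algebra over $\mathbb F$ with basis $e_1,e_2$ and restricted structure $(\alpha_1e_1+\alpha_2e_2)^{[2]}=(\alpha_1^2\lambda_1+\alpha_2^2\lambda_2)e_2$. (It is the case $p=2$ of the Lie algebra with basis $e_1,\dots,e_p$, brackets $[e_1,e_i]=e_{i+1}$ for $1<i<p$, and $e_k^{[p]}=\lambda_ke_p$.) Ordinary cochains (trivial coefficients $\mathbb F$): $C^n(\mathfrak g)=(\wedge^n\mathfrak g)^*$, with $d^1(\psi)(g,h)=\psi([g,h])$ and $d^2(\phi)(g,h,f)=\phi([g,h]\wedge f)-\phi([g,f]\wedge h)+\phi([h,f]\wedge g)$ (both zero here). Restricted cochains: $C^1_*(\mathfrak g)=\mathfrak g^*$; $C^2_*(\mathfrak g)$ is the vector space of pairs $(\phi,\omega)$ with $\phi\in C^2(\mathfrak g)$ and $\omega:\mathfrak g\to\mathbb F$ a map satisfying $\omega(\alpha g)=\alpha^2\omega(g)$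 and $\omega(g+h)=\omega(g)+\omega(h)+\phi(g\wedge h)$ for all $g,h\in\mathfrak g$, $\alpha\in\mathbb F$ (this is the $*$-property with respect to $\phi$ for $p=2$). Put $\overline e^k(\alpha_1e_1+\alpha_2e_2)=\alpha_k^2$ for $k=1,2$. Restricted differentials: $d^1_*(\psi)=(d^1\psi,\operatorname{ind}^1(\psi))$ with $\operatorname{ind}^1(\psi)(g)=\psi(g^{[2]})$, and $d^2_*(\phi,\omega)=(d^2\phi,\operatorname{ind}^2(\phi,\omega))$, where $\operatorname{ind}^2(\phi,\omega):\mathfrak g\times\mathfrak g\to\mathbb F$ is $\operatorname{ind}^2(\phi,\omega)(g,h)=\phi(g\wedge h^{[2]})$. Thus $\ker d^2_*$ consists of the pairs with $d^2\phi=0$ and $\operatorname{ind}^2(\phi,\omega)=0$, and $H^2_*(\mathfrak g)=\ker d^2_*/\operatorname{im}d^1_*$. *)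

theory Defs
  imports "Jordan_Normal_Form.VS_Connect" "HOL-Algebra.AbelCoset" "HOL-Library.Product_Plus"
begin

section \<open>Quotients of modules\<close>

text \<open>The scalar multiple of a coset \<open>X\<close> is the union of the cosets of \<open>a x\<close> for \<open>x \<in> X\<close>
  (all equal when \<open>N\<close> is a submodule); the plain image would be wrong for \<open>a = 0\<close>.
  The ring fields \<open>mult\<close> and \<open>one\<close> of a module record carry no meaning.\<close>

definition quotient_module ::
  "('a, 'm, 'x) module_scheme \<Rightarrow> 'm set \<Rightarrow> ('a, 'm set) module" where
  "quotient_module M N =
    \<lparr> carrier = a_rcosets\<^bsub>M\<^esub> N, mult = undefined, one = undefined,
      zero = N, add = (\<lambda>X Y. X <+>\<^bsub>M\<^esub> Y),
      smult = (\<lambda>a X. \<Union>x\<in>X. N +>\<^bsub>M\<^esub> (a \<odot>\<^bsub>M\<^esub> x)) \<rparr>"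

lemma quotient_module_vectorspace:
  assumes V: "vectorspace K V" and N: "submodule K N V"
  shows "vectorspace K (quotient_module V N)"
proof -
  interpret V: vectorspace K V by (rule V)
  interpret N: submodule K N V by (rule N)
  have sg: "subgroup N (add_monoid V)"
  proof
    fix x assume "x \<in> N"
    then have "(\<ominus>\<^bsub>K\<^esub> \<one>\<^bsub>K\<^esub>) \<odot>\<^bsub>V\<^esub> x \<in> N" by auto
    then have "\<ominus>\<^bsub>V\<^esub> x \<in> N"
      using V.smult_minus_1[of x] \<open>x \<in> N\<close> N.subset by (metis subsetD)
    then show "inv\<^bsub>add_monoid V\<^esub> x \<in> N" by (simp add: a_inv_def)
  qed (use N.subset in auto)
  interpret ab: abelian_subgroup N V
    by (intro abelian_subgroupI3 additive_subgroup.intro sg V.abelian_group_axioms)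
  let ?Q = "quotient_module V N"
  have car: "X \<in> carrier ?Q \<longleftrightarrow> (\<exists>x\<in>carrier V. X = N +>\<^bsub>V\<^esub> x)" for X
    by (auto simp: quotient_module_def A_RCOSETS_def')
  have add: "(N +>\<^bsub>V\<^esub> x) \<oplus>\<^bsub>?Q\<^esub> (N +>\<^bsub>V\<^esub> y) = N +>\<^bsub>V\<^esub> (x \<oplus>\<^bsub>V\<^esub> y)"
    if "x \<in> carrier V" "y \<in> carrier V" for x y
    using that by (simp add: quotient_module_def ab.a_rcos_sum)
  have zero: "\<zero>\<^bsub>?Q\<^esub> = N +>\<^bsub>V\<^esub> \<zero>\<^bsub>V\<^esub>"
    using N.subset by (simp add: quotient_module_def V.a_coset_add_zero)
  have ag: "abelian_group ?Q"
  proof (rule abelian_groupI, goal_cases)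
    case (6 X)
    then obtain x where x: "x \<in> carrier V" "X = N +>\<^bsub>V\<^esub> x" by (auto simp: car)
    then show ?case
      by (intro bexI[of _ "N +>\<^bsub>V\<^esub> (\<ominus>\<^bsub>V\<^esub> x)"]) (auto simp: car add zero V.l_neg)
  qed (auto simp: car add zero V.a_ac)
  have sm: "a \<odot>\<^bsub>?Q\<^esub> (N +>\<^bsub>V\<^esub> x) = N +>\<^bsub>V\<^esub> (a \<odot>\<^bsub>V\<^esub> x)"
    if a: "a \<in> carrier K" and x: "x \<in> carrier V" for a x
  proof -
    have "N +>\<^bsub>V\<^esub> (a \<odot>\<^bsub>V\<^esub> y) = N +>\<^bsub>V\<^esub> (a \<odot>\<^bsub>V\<^esub> x)" if "y \<in> N +>\<^bsub>V\<^esub> x" for y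
    proof -
      from that obtain n where n: "n \<in> N" "y = n \<oplus>\<^bsub>V\<^esub> x"
        by (auto simp: a_r_coset_def')
      have nV: "n \<in> carrier V" using n N.subset by auto
      have "a \<odot>\<^bsub>V\<^esub> y = a \<odot>\<^bsub>V\<^esub> n \<oplus>\<^bsub>V\<^esub> a \<odot>\<^bsub>V\<^esub> x"
        using n a x nV by (simp add: V.smult_r_distr)
      moreover have "a \<odot>\<^bsub>V\<^esub> n \<in> N" using a n by auto
      ultimately have "a \<odot>\<^bsub>V\<^esub> y \<in> N +>\<^bsub>V\<^esub> (a \<odot>\<^bsub>V\<^esub> x)"
        by (auto simp: a_r_coset_def')
      then show ?thesis
        using a x ab.a_repr_independence'[of "a \<odot>\<^bsub>V\<^esub> y" "a \<odot>\<^bsub>V\<^esub> x"] by auto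
    qed
    moreover have "x \<in> N +>\<^bsub>V\<^esub> x" using x by (rule ab.a_rcos_self)
    ultimately have "(\<Union>y\<in>N +>\<^bsub>V\<^esub> x. N +>\<^bsub>V\<^esub> (a \<odot>\<^bsub>V\<^esub> y)) = N +>\<^bsub>V\<^esub> (a \<odot>\<^bsub>V\<^esub> x)"
      by blast
    then show ?thesis by (simp add: quotient_module_def)
  qed
  have "module K ?Q"
  proof (rule moduleI[OF V.is_cring ag], goal_cases)
    case (1 a X)
    then obtain x where "x \<in> carrier V" "X = N +>\<^bsub>V\<^esub> x" by (auto simp: car)
    with 1 show ?case
      unfolding car by (intro bexI[of _ "a \<odot>\<^bsub>V\<^esub> x"]) (simp_all add: sm)
  next
    case (2 a b X)
    then obtain x where "x \<in> carrier V" "X = N +>\<^bsub>V\<^esub> x" by (auto simp: car)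
    with 2 show ?case by (simp add: sm add V.smult_l_distr)
  next
    case (3 a X Y)
    then obtain x y where "x \<in> carrier V" "X = N +>\<^bsub>V\<^esub> x" "y \<in> carrier V" "Y = N +>\<^bsub>V\<^esub> y"
      by (auto simp: car)
    with 3 show ?case by (simp add: sm add V.smult_r_distr)
  next
    case (4 a b X)
    then obtain x where "x \<in> carrier V" "X = N +>\<^bsub>V\<^esub> x" by (auto simp: car)
    with 4 show ?case by (simp add: sm V.smult_assoc1)
  next
    case (5 X)
    then obtain x where "x \<in> carrier V" "X = N +>\<^bsub>V\<^esub> x" by (auto simp: car)
    then show ?case by (simp add: sm)
  qed
  then show ?thesis
    by (intro vectorspace.intro V.field_axioms)
qed

section \<open>Low-degree cochains in characteristic 2\<close>

text \<open>The underlying vector space is a type \<open>'g\<close> with scalar multiplication \<open>s\<close>; \<open>br\<close> is the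
  Lie bracket and \<open>pm\<close> the map \<open>g \<mapsto> g\<^sup>[\<^sup>2\<^sup>]\<close>. Coefficients are trivial.
  Linear forms on \<open>\<Lambda>\<^sup>2 \<gg>\<close> are alternating bilinear forms \<open>\<phi>\<close>, with \<open>\<phi> g h\<close> for
  \<open>\<phi>(g \<and> h)\<close>; in characteristic 2 alternating is stronger than antisymmetric.\<close>

definition cochains1 :: "('a::field \<Rightarrow> 'g::ab_group_add \<Rightarrow> 'g) \<Rightarrow> ('g \<Rightarrow> 'a) set" where
  "cochains1 s = {\<psi>. Vector_Spaces.linear s (*) \<psi>}"

definition cochains2 :: "('a::field \<Rightarrow> 'g::ab_group_add \<Rightarrow> 'g) \<Rightarrow> ('g \<Rightarrow> 'g \<Rightarrow> 'a) set" where
  "cochains2 s = {\<phi>. (\<forall>g. Vector_Spaces.linear s (*) (\<lambda>h. \<phi> g h)) \<and>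
                     (\<forall>h. Vector_Spaces.linear s (*) (\<lambda>g. \<phi> g h)) \<and>
                     (\<forall>g. \<phi> g g = 0)}"

definition diff1 :: "('g \<Rightarrow> 'g \<Rightarrow> 'g) \<Rightarrow> ('g \<Rightarrow> 'a) \<Rightarrow> 'g \<Rightarrow> 'g \<Rightarrow> 'a" where
  "diff1 br \<psi> = (\<lambda>g h. \<psi> (br g h))"

definition diff2 ::
  "('g \<Rightarrow> 'g \<Rightarrow> 'g) \<Rightarrow> ('g \<Rightarrow> 'g \<Rightarrow> 'a::field) \<Rightarrow> 'g \<Rightarrow> 'g \<Rightarrow> 'g \<Rightarrow> 'a" where
  "diff2 br \<phi> = (\<lambda>g h f. \<phi> (br g h) f - \<phi> (br g f) h + \<phi> (br h f) g)"

definition star_property ::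
  "('a::field \<Rightarrow> 'g::ab_group_add \<Rightarrow> 'g) \<Rightarrow> ('g \<Rightarrow> 'g \<Rightarrow> 'a) \<Rightarrow> ('g \<Rightarrow> 'a) \<Rightarrow> bool" where
  "star_property s \<phi> \<omega> \<longleftrightarrow>
     (\<forall>\<alpha> g. \<omega> (s \<alpha> g) = \<alpha>\<^sup>2 * \<omega> g) \<and>
     (\<forall>g h. \<omega> (g + h) = \<omega> g + \<omega> h + \<phi> g h)"

definition restr_cochains2 ::
  "('a::field \<Rightarrow> 'g::ab_group_add \<Rightarrow> 'g) \<Rightarrow> ('a, ('g \<Rightarrow> 'g \<Rightarrow> 'a) \<times> ('g \<Rightarrow> 'a)) module" where
  "restr_cochains2 s =
    \<lparr> carrier = {(\<phi>, \<omega>). \<phi> \<in> cochains2 s \<and> star_property s \<phi> \<omega>},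
      mult = undefined, one = undefined,
      zero = ((\<lambda>g h. 0), (\<lambda>g. 0)),
      add = (\<lambda>(\<phi>, \<omega>) (\<phi>', \<omega>'). ((\<lambda>g h. \<phi> g h + \<phi>' g h), (\<lambda>g. \<omega> g + \<omega>' g))),
      smult = (\<lambda>a (\<phi>, \<omega>). ((\<lambda>g h. a * \<phi> g h), (\<lambda>g. a * \<omega> g))) \<rparr>"

definition ind1 :: "('g \<Rightarrow> 'g) \<Rightarrow> ('g \<Rightarrow> 'a) \<Rightarrow> 'g \<Rightarrow> 'a" where
  "ind1 pm \<psi> = (\<lambda>g. \<psi> (pm g))"

definition ind2 ::
  "('g \<Rightarrow> 'g) \<Rightarrow> ('g \<Rightarrow> 'g \<Rightarrow> 'a) \<times> ('g \<Rightarrow> 'a) \<Rightarrow> 'g \<Rightarrow> 'g \<Rightarrow> 'a" where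
  "ind2 pm = (\<lambda>(\<phi>, \<omega>) g h. \<phi> g (pm h))"

definition restr_diff1 ::
  "('g \<Rightarrow> 'g \<Rightarrow> 'g) \<Rightarrow> ('g \<Rightarrow> 'g) \<Rightarrow> ('g \<Rightarrow> 'a) \<Rightarrow> ('g \<Rightarrow> 'g \<Rightarrow> 'a) \<times> ('g \<Rightarrow> 'a)" where
  "restr_diff1 br pm \<psi> = (diff1 br \<psi>, ind1 pm \<psi>)"

definition restr_diff2 ::
  "('g \<Rightarrow> 'g \<Rightarrow> 'g) \<Rightarrow> ('g \<Rightarrow> 'g) \<Rightarrow> ('g \<Rightarrow> 'g \<Rightarrow> 'a::field) \<times> ('g \<Rightarrow> 'a)
     \<Rightarrow> ('g \<Rightarrow> 'g \<Rightarrow> 'g \<Rightarrow> 'a) \<times> ('g \<Rightarrow> 'g \<Rightarrow> 'a)" where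
  "restr_diff2 br pm c = (diff2 br (fst c), ind2 pm c)"

definition restr_cocycles2 ::
  "('a::field \<Rightarrow> 'g::ab_group_add \<Rightarrow> 'g) \<Rightarrow> ('g \<Rightarrow> 'g \<Rightarrow> 'g) \<Rightarrow> ('g \<Rightarrow> 'g)
     \<Rightarrow> (('g \<Rightarrow> 'g \<Rightarrow> 'a) \<times> ('g \<Rightarrow> 'a)) set" where
  "restr_cocycles2 s br pm =
     {c \<in> carrier (restr_cochains2 s). restr_diff2 br pm c = ((\<lambda>g h f. 0), (\<lambda>g h. 0))}"

definition restr_coboundaries2 ::
  "('a::field \<Rightarrow> 'g::ab_group_add \<Rightarrow> 'g) \<Rightarrow> ('g \<Rightarrow> 'g \<Rightarrow> 'g) \<Rightarrow> ('g \<Rightarrow> 'g)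
     \<Rightarrow> (('g \<Rightarrow> 'g \<Rightarrow> 'a) \<times> ('g \<Rightarrow> 'a)) set" where
  "restr_coboundaries2 s br pm = restr_diff1 br pm ` cochains1 s"

definition restr_H2 ::
  "('a::field \<Rightarrow> 'g::ab_group_add \<Rightarrow> 'g) \<Rightarrow> ('g \<Rightarrow> 'g \<Rightarrow> 'g) \<Rightarrow> ('g \<Rightarrow> 'g)
     \<Rightarrow> ('a, (('g \<Rightarrow> 'g \<Rightarrow> 'a) \<times> ('g \<Rightarrow> 'a)) set) module" where
  "restr_H2 s br pm =
     quotient_module ((restr_cochains2 s)\<lparr>carrier := restr_cocycles2 s br pm\<rparr>)
       (restr_coboundaries2 s br pm)"

definition restr_class2 ::
  "('a::field \<Rightarrow> 'g::ab_group_add \<Rightarrow> 'g) \<Rightarrow> ('g \<Rightarrow> 'g \<Rightarrow> 'g) \<Rightarrow> ('g \<Rightarrow> 'g)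
     \<Rightarrow> ('g \<Rightarrow> 'g \<Rightarrow> 'a) \<times> ('g \<Rightarrow> 'a) \<Rightarrow> (('g \<Rightarrow> 'g \<Rightarrow> 'a) \<times> ('g \<Rightarrow> 'a)) set" where
  "restr_class2 s br pm c = restr_coboundaries2 s br pm +>\<^bsub>restr_cochains2 s\<^esub> c"

lemma linear_form_iff:
  assumes "vector_space s"
  shows "Vector_Spaces.linear s (*) f \<longleftrightarrow>
    (\<forall>g h. f (g + h) = f g + f h) \<and> (\<forall>\<alpha> g. f (s \<alpha> g) = \<alpha> * f g)"
proof -
  have "vector_space ((*) :: 'a::field \<Rightarrow> 'a \<Rightarrow> 'a)"
    by unfold_locales (auto simp: algebra_simps)
  with assms show ?thesis
    by (simp add: Vector_Spaces.linear_def module_hom_def module_hom_axioms_def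
        vector_space_def Modules.module_def)
qed

lemma restr_cochains2_vectorspace:
  assumes s: "vector_space s"
  shows "vectorspace class_ring (restr_cochains2 s)"
proof -
  note defs = restr_cochains2_def cochains2_def star_property_def linear_form_iff[OF s]
  have "abelian_group (restr_cochains2 s)"
  proof (rule abelian_groupI, goal_cases)
    case (6 x)
    obtain \<phi> \<omega> where x: "x = (\<phi>, \<omega>)" by (cases x)
    show ?case
      using 6 by (intro bexI[of _ "((\<lambda>g h. - \<phi> g h), (\<lambda>g. - \<omega> g))"])
        (auto simp: defs x)
  qed (auto simp: defs algebra_simps)
  then have "module class_ring (restr_cochains2 s)"
    by (intro moduleI[OF class_cring.is_cring])
      (auto simp: defs algebra_simps)
  then show ?thesis
    by (intro vectorspace.intro class_field)
qed

lemma restr_cocycles2_subspace: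
  assumes s: "vector_space s"
  shows "submodule class_ring (restr_cocycles2 s br pm) (restr_cochains2 s)"
proof -
  interpret V: vectorspace class_ring "restr_cochains2 s"
    by (rule restr_cochains2_vectorspace[OF s])
  show ?thesis
  proof (rule submodule.intro, goal_cases)
    case 1 show ?case by (rule V.module_axioms)
  next
    case 2 show ?case by (auto simp: restr_cocycles2_def)
  next
    case (3 v w)
    then have "v \<oplus>\<^bsub>restr_cochains2 s\<^esub> w \<in> carrier (restr_cochains2 s)"
      by (intro V.a_closed) (auto simp: restr_cocycles2_def)
    with 3 show ?case
      by (auto simp: restr_cocycles2_def restr_diff2_def diff2_def ind2_def fun_eq_iff
          restr_cochains2_def case_prod_unfold algebra_simps)
  next
    case 4
    have "\<zero>\<^bsub>restr_cochains2 s\<^esub> \<in> carrier (restr_cochains2 s)" by (rule V.zero_closed)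
    then show ?case
      by (auto simp: restr_cocycles2_def restr_diff2_def diff2_def ind2_def fun_eq_iff
          restr_cochains2_def)
  next
    case (5 c v)
    then have "c \<odot>\<^bsub>restr_cochains2 s\<^esub> v \<in> carrier (restr_cochains2 s)"
      by (intro V.smult_closed) (auto simp: restr_cocycles2_def)
    with 5 show ?case
      by (auto simp: restr_cocycles2_def restr_diff2_def diff2_def ind2_def fun_eq_iff
          restr_cochains2_def case_prod_unfold simp flip: right_diff_distrib distrib_left)
  qed
qed

section \<open>The restricted Lie algebra \<open>\<mm>\<^sub>0\<^sup>\<lambda>(2)\<close>\<close>

text \<open>The pair \<open>(\<alpha>\<^sub>1, \<alpha>\<^sub>2)\<close> is \<open>\<alpha>\<^sub>1 e\<^sub>1 + \<alpha>\<^sub>2 e\<^sub>2\<close>. The defining brackets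
  \<open>[e\<^sub>1, e\<^sub>i] = e\<^sub>i\<^sub>+\<^sub>1\<close> for \<open>1 < i < p\<close> are vacuous for \<open>p = 2\<close>, so the bracket is zero.\<close>

definition pair_scale :: "'a::field \<Rightarrow> 'a \<times> 'a \<Rightarrow> 'a \<times> 'a" where
  "pair_scale c = (\<lambda>(\<alpha>\<^sub>1, \<alpha>\<^sub>2). (c * \<alpha>\<^sub>1, c * \<alpha>\<^sub>2))"

definition m0_bracket :: "'a::field \<times> 'a \<Rightarrow> 'a \<times> 'a \<Rightarrow> 'a \<times> 'a" where
  "m0_bracket g h = 0"

definition m0_pmap :: "'a::field \<times> 'a \<Rightarrow> 'a \<times> 'a \<Rightarrow> 'a \<times> 'a" where
  "m0_pmap = (\<lambda>(l\<^sub>1, l\<^sub>2) (\<alpha>\<^sub>1, \<alpha>\<^sub>2). pair_scale (\<alpha>\<^sub>1\<^sup>2 * l\<^sub>1 + \<alpha>\<^sub>2\<^sup>2 * l\<^sub>2) (0, 1))"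

definition ebar1 :: "'a::field \<times> 'a \<Rightarrow> 'a" where
  "ebar1 = (\<lambda>(\<alpha>\<^sub>1, \<alpha>\<^sub>2). \<alpha>\<^sub>1\<^sup>2)"

definition ebar2 :: "'a::field \<times> 'a \<Rightarrow> 'a" where
  "ebar2 = (\<lambda>(\<alpha>\<^sub>1, \<alpha>\<^sub>2). \<alpha>\<^sub>2\<^sup>2)"

abbreviation m0_H2 ::
  "'a::field \<times> 'a \<Rightarrow> ('a, (('a \<times> 'a \<Rightarrow> 'a \<times> 'a \<Rightarrow> 'a) \<times> ('a \<times> 'a \<Rightarrow> 'a)) set) module" where
  "m0_H2 lam \<equiv> restr_H2 pair_scale m0_bracket (m0_pmap lam)"

abbreviation m0_class2 ::
  "'a::field \<times> 'a \<Rightarrow> ('a \<times> 'a \<Rightarrow> 'a \<times> 'a \<Rightarrow> 'a) \<times> ('a \<times> 'a \<Rightarrow> 'a)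
     \<Rightarrow> (('a \<times> 'a \<Rightarrow> 'a \<times> 'a \<Rightarrow> 'a) \<times> ('a \<times> 'a \<Rightarrow> 'a)) set" where
  "m0_class2 lam \<equiv> restr_class2 pair_scale m0_bracket (m0_pmap lam)"

lemma vector_space_pair_scale: "vector_space (pair_scale :: 'a::field \<Rightarrow> _)"
  by unfold_locales (auto simp: pair_scale_def algebra_simps)

text \<open>The axioms of a restricted Lie algebra in characteristic 2 (the Lie algebra axioms are
  trivial for the zero bracket).\<close>

lemma m0_pmap_restricted:
  assumes "CHAR('a::field) = 2"
  shows "m0_pmap lam (g + h) = m0_pmap lam g + m0_pmap lam h + m0_bracket g (h :: 'a \<times> 'a)"
    and "m0_pmap lam (pair_scale c g) = pair_scale (c\<^sup>2) (m0_pmap lam g)"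
    and "m0_bracket (m0_pmap lam g) h = m0_bracket g (m0_bracket g h)"
proof -
  have "(2 :: 'a) = 0"
    using of_nat_CHAR[where 'a = 'a] assms by simp
  then show "m0_pmap lam (g + h) = m0_pmap lam g + m0_pmap lam h + m0_bracket g h"
    by (cases g; cases h; cases lam)
      (simp add: m0_pmap_def m0_bracket_def pair_scale_def power2_sum algebra_simps)
qed (auto simp: m0_pmap_def m0_bracket_def pair_scale_def case_prod_unfold algebra_simps
    power_mult_distrib)

lemma m0_coboundaries2_subspace:
  fixes lam :: "'a::field \<times> 'a"
  assumes char: "CHAR('a) = 2"
  shows "submodule class_ring (restr_coboundaries2 pair_scale m0_bracket (m0_pmap lam))
    ((restr_cochains2 pair_scale)\<lparr>carrier := restr_cocycles2 pair_scale m0_bracket (m0_pmap lam)\<rparr>)"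
proof -
  let ?Z = "(restr_cochains2 pair_scale)
    \<lparr>carrier := restr_cocycles2 pair_scale m0_bracket (m0_pmap lam)\<rparr>"
  interpret V: vectorspace class_ring "restr_cochains2 (pair_scale :: 'a \<Rightarrow> _)"
    by (rule restr_cochains2_vectorspace[OF vector_space_pair_scale])
  note lin = linear_form_iff[OF vector_space_pair_scale]
  have [simp]: "\<psi> 0 = 0" if "\<forall>g h. \<psi> (g + h) = \<psi> g + \<psi> h" for \<psi> :: "'a \<times> 'a \<Rightarrow> 'a"
    using that by (metis add.right_neutral add_left_cancel)
  have B: "restr_coboundaries2 pair_scale m0_bracket (m0_pmap lam) =
    {((\<lambda>g h. 0), (\<lambda>g. \<psi> (m0_pmap lam g))) | \<psi>. \<psi> \<in> cochains1 pair_scale}"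
    by (auto simp: restr_coboundaries2_def restr_diff1_def diff1_def ind1_def m0_bracket_def
        cochains1_def lin image_iff)
  show ?thesis
  proof (rule submodule.intro, goal_cases)
    case 1 show ?case
      by (rule V.submodule_is_module[OF restr_cocycles2_subspace[OF vector_space_pair_scale]])
  next
    case 2
    have "((\<lambda>g h. 0), (\<lambda>g. \<psi> (m0_pmap lam g))) \<in> carrier ?Z"
      if "\<psi> \<in> cochains1 pair_scale" for \<psi>
    proof -
      have "\<psi> (g + h) = \<psi> g + \<psi> h" "\<psi> (pair_scale c g) = c * \<psi> g" for g h c
        using that by (simp_all add: cochains1_def lin del: split_paired_All)
      then show ?thesis
        by (simp add: restr_cocycles2_def restr_cochains2_def cochains2_def star_property_def lin
            m0_pmap_restricted[OF char] m0_bracket_def restr_diff2_def diff2_def ind2_def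
            del: split_paired_All)
    qed
    then show ?case by (auto simp: B)
  next
    case (3 v w)
    then obtain \<psi> \<psi>' where "\<psi> \<in> cochains1 pair_scale" "\<psi>' \<in> cochains1 pair_scale"
      "v = ((\<lambda>g h. 0), (\<lambda>g. \<psi> (m0_pmap lam g)))" "w = ((\<lambda>g h. 0), (\<lambda>g. \<psi>' (m0_pmap lam g)))"
      by (auto simp: B)
    then show ?case
      by (auto simp: B restr_cochains2_def cochains1_def lin algebra_simps
          intro!: exI[of _ "\<lambda>g. \<psi> g + \<psi>' g"])
  next
    case 4 show ?case
      by (auto simp: B restr_cochains2_def cochains1_def lin intro!: exI[of _ "\<lambda>g. 0"])
  next
    case (5 c v)
    then obtain \<psi> where "\<psi> \<in> cochains1 pair_scale" "v = ((\<lambda>g h. 0), (\<lambda>g. \<psi> (m0_pmap lam g)))"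
      by (auto simp: B)
    then show ?case
      by (auto simp: B restr_cochains2_def cochains1_def lin algebra_simps
          intro!: exI[of _ "\<lambda>g. c * \<psi> g"])
  qed
qed

lemma m0_H2_vectorspace:
  fixes lam :: "'a::field \<times> 'a"
  assumes "CHAR('a) = 2"
  shows "vectorspace class_ring (m0_H2 lam)"
proof -
  interpret V: vectorspace class_ring "restr_cochains2 (pair_scale :: 'a \<Rightarrow> _)"
    by (rule restr_cochains2_vectorspace[OF vector_space_pair_scale])
  have "vectorspace class_ring
    ((restr_cochains2 pair_scale)\<lparr>carrier := restr_cocycles2 pair_scale m0_bracket (m0_pmap lam)\<rparr>)"
    by (intro vectorspace.intro V.submodule_is_module class_field
        restr_cocycles2_subspace vector_space_pair_scale)
  then show ?thesis
    unfolding restr_H2_def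
    by (rule quotient_module_vectorspace) (rule m0_coboundaries2_subspace[OF assms])
qed

end

theory Submission
  imports Defs
begin

text \<open>For \<open>\<lambda> \<noteq> 0\<close> the image of \<open>g \<mapsto> g\<^sup>[\<^sup>2\<^sup>]\<close> contains a nonzero multiple of \<open>e\<^sub>2\<close>, so the cocycle
  condition forces \<open>\<phi>(e\<^sub>1 \<and> e\<^sub>2) = 0\<close>, i.e. \<open>\<phi> = 0\<close>. Then \<open>\<omega>\<close> is 2-semilinear, and the cocycles form
  the plane spanned by \<open>(0, ebar1)\<close> and \<open>(0, ebar2)\<close>, in which the coboundaries are the line
  through \<open>(0, \<lambda>\<^sub>1 ebar1 + \<lambda>\<^sub>2 ebar2)\<close>.\<close>

lemma (in vectorspace) basis_singleton:
  assumes v: "v \<in> carrier V" "v \<noteq> \<zero>\<^bsub>V\<^esub>"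
    and gen: "\<And>x. x \<in> carrier V \<Longrightarrow> \<exists>a\<in>carrier K. x = a \<odot>\<^bsub>V\<^esub> v"
  shows "basis {v}"
proof -
  have lc: "lincomb a {v} = a v \<odot>\<^bsub>V\<^esub> v" if "a v \<in> carrier K" for a
    using that v by (simp add: lincomb_def)
  have "lin_indpt {v}"
  proof (rule finite_lin_indpt2)
    fix a assume a: "a \<in> {v} \<rightarrow> carrier K" and z: "lincomb a {v} = \<zero>\<^bsub>V\<^esub>"
    then have av: "a v \<odot>\<^bsub>V\<^esub> v = \<zero>\<^bsub>V\<^esub>" by (auto simp: lc)
    have "a v = \<zero>\<^bsub>K\<^esub>"
    proof (rule ccontr)
      assume "a v \<noteq> \<zero>\<^bsub>K\<^esub>"
      then have U: "a v \<in> Units K" using a by (auto simp: field_Units)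
      then have "v = (inv\<^bsub>K\<^esub> a v \<otimes>\<^bsub>K\<^esub> a v) \<odot>\<^bsub>V\<^esub> v" using v by simp
      also have "\<dots> = inv\<^bsub>K\<^esub> a v \<odot>\<^bsub>V\<^esub> (a v \<odot>\<^bsub>V\<^esub> v)"
        using U a v by (intro smult_assoc1) auto
      also have "\<dots> = \<zero>\<^bsub>V\<^esub>" using U av by simp
      finally show False using v by simp
    qed
    then show "\<forall>w\<in>{v}. a w = \<zero>\<^bsub>K\<^esub>" by simp
  qed (use v in auto)
  moreover have "gen_set {v}"
  proof
    show "span {v} \<subseteq> carrier V" using v by (intro span_is_subset2) auto
    show "carrier V \<subseteq> span {v}"
    proof
      fix x assume "x \<in> carrier V"
      then obtain a where a: "a \<in> carrier K" "x = a \<odot>\<^bsub>V\<^esub> v" using gen by blast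
      then have "x = lincomb (\<lambda>_. a) {v}" by (simp add: lc)
      then show "x \<in> span {v}" using a unfolding span_def by blast
    qed
  qed
  ultimately show ?thesis using v by (auto simp: basis_def)
qed

text \<open>Closure under negation comes from scaling by -1. This gives access to the coset facts of
  \<open>abelian_subgroup\<close>.\<close>

lemma submodule_imp_abelian_subgroup:
  assumes V: "vectorspace K V" and N: "submodule K N V"
  shows "abelian_subgroup N V"
proof -
  interpret V: vectorspace K V by (rule V)
  interpret N: submodule K N V by (rule N)
  have "\<ominus>\<^bsub>V\<^esub> x \<in> N" if "x \<in> N" for x
    using that N.smult_closed[of "\<ominus>\<^bsub>K\<^esub> \<one>\<^bsub>K\<^esub>" x] N.subset V.smult_minus_1[of x]
    by (metis V.R.a_inv_closed V.R.one_closed subsetD)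
  then have "subgroup N (add_monoid V)"
    using N.subset by unfold_locales (auto simp: a_inv_def)
  then show ?thesis
    by (intro abelian_subgroupI3 additive_subgroup.intro V.abelian_group_axioms)
qed

text \<open>All cosets in the defining union coincide: replacing x by n + x with n in
  \<open>N\<close> changes a x by a n, which lies in \<open>N\<close> again.\<close>

lemma quotient_module_smult:
  assumes V: "vectorspace K V" and N: "submodule K N V"
    and a: "a \<in> carrier K" and x: "x \<in> carrier V"
  shows "a \<odot>\<^bsub>quotient_module V N\<^esub> (N +>\<^bsub>V\<^esub> x) = N +>\<^bsub>V\<^esub> (a \<odot>\<^bsub>V\<^esub> x)"
proof -
  interpret V: vectorspace K V by (rule V)
  interpret N: submodule K N V by (rule N)
  interpret abelian_subgroup N V by (rule submodule_imp_abelian_subgroup[OF V N])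
  have "N +>\<^bsub>V\<^esub> (a \<odot>\<^bsub>V\<^esub> (n \<oplus>\<^bsub>V\<^esub> x)) = N +>\<^bsub>V\<^esub> (a \<odot>\<^bsub>V\<^esub> x)" if n: "n \<in> N" for n
  proof -
    have "a \<odot>\<^bsub>V\<^esub> (n \<oplus>\<^bsub>V\<^esub> x) \<in> N +>\<^bsub>V\<^esub> (a \<odot>\<^bsub>V\<^esub> x)"
      using n a x N.subset by (auto simp: V.smult_r_distr a_r_coset_def')
    then show ?thesis using a x a_repr_independence' by auto
  qed
  then show ?thesis
    by (auto simp: quotient_module_def a_r_coset_def')
qed

text \<open>Since V = N + K v, every coset is a multiple of that of v, and this one is nonzero
  because v lies in its own coset but not in \<open>N\<close>, the zero of the quotient. Computing
  the cohomology thus reduces to finding a line that complements the coboundaries in the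
  cocycles.\<close>

lemma quotient_module_line:
  assumes V: "vectorspace K V" and N: "submodule K N V"
    and v: "v \<in> carrier V" "v \<notin> N"
    and gen: "\<And>x. x \<in> carrier V \<Longrightarrow> \<exists>a\<in>carrier K. \<exists>n\<in>N. x = n \<oplus>\<^bsub>V\<^esub> a \<odot>\<^bsub>V\<^esub> v"
  shows "vectorspace.basis K (quotient_module V N) {N +>\<^bsub>V\<^esub> v}"
    and "vectorspace.dim K (quotient_module V N) = 1"
proof -
  interpret V: vectorspace K V by (rule V)
  interpret N: submodule K N V by (rule N)
  interpret abelian_subgroup N V by (rule submodule_imp_abelian_subgroup[OF V N])
  interpret Q: vectorspace K "quotient_module V N" by (rule quotient_module_vectorspace[OF V N])
  have car: "X \<in> carrier (quotient_module V N) \<longleftrightarrow> (\<exists>x\<in>carrier V. X = N +>\<^bsub>V\<^esub> x)" for X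
    by (auto simp: quotient_module_def A_RCOSETS_def')
  show basis: "Q.basis {N +>\<^bsub>V\<^esub> v}"
  proof (rule Q.basis_singleton)
    show "N +>\<^bsub>V\<^esub> v \<in> carrier (quotient_module V N)" using v car by auto
    show "N +>\<^bsub>V\<^esub> v \<noteq> \<zero>\<^bsub>quotient_module V N\<^esub>"
      using v a_rcos_self[of v] by (auto simp: quotient_module_def)
  next
    fix X assume "X \<in> carrier (quotient_module V N)"
    then obtain x where x: "x \<in> carrier V" "X = N +>\<^bsub>V\<^esub> x" by (auto simp: car)
    then obtain a n where a: "a \<in> carrier K" "n \<in> N" "x = n \<oplus>\<^bsub>V\<^esub> a \<odot>\<^bsub>V\<^esub> v" using gen by blast
    then have "x \<in> N +>\<^bsub>V\<^esub> (a \<odot>\<^bsub>V\<^esub> v)" by (auto simp: a_r_coset_def')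
    then have "X = N +>\<^bsub>V\<^esub> (a \<odot>\<^bsub>V\<^esub> v)" using x a v a_repr_independence' by auto
    then show "\<exists>a\<in>carrier K. X = a \<odot>\<^bsub>quotient_module V N\<^esub> (N +>\<^bsub>V\<^esub> v)"
      using a v by (auto simp: quotient_module_smult[OF V N])
  qed
  show "Q.dim = 1" using Q.dim_basis[OF _ basis] by simp
qed

lemma linear_form_pair:
  assumes "Vector_Spaces.linear pair_scale (*) f"
  shows "f (x, y) = x * f (1, 0) + y * f (0, 1)"
proof -
  \<comment> \<open>The linearity laws quantify over pairs; without \<open>split_paired_All\<close>
    they stay usable as rewrite rules for sums and multiples of vectors.\<close>
  have "f (pair_scale x (1, 0) + pair_scale y (0, 1)) = x * f (1, 0) + y * f (0, 1)"
    using assms by (simp add: linear_form_iff[OF vector_space_pair_scale] del: split_paired_All)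
  then show ?thesis by (simp add: pair_scale_def)
qed

text \<open>The bracket is zero and every value of \<open>m0_pmap\<close> is a multiple of e_2, so
  the coboundary of a form depends only on its value at e_2. That value is the parameter c.\<close>

lemma m0_coboundaries2_eq:
  "restr_coboundaries2 pair_scale m0_bracket (m0_pmap (l\<^sub>1, l\<^sub>2)) =
    range (\<lambda>c. ((\<lambda>g h. 0), (\<lambda>g. c * (l\<^sub>1 * ebar1 g + l\<^sub>2 * ebar2 g))))"
    (is "?B = range ?r")
proof -
  have 1: "restr_diff1 m0_bracket (m0_pmap (l\<^sub>1, l\<^sub>2)) \<psi> = ?r (\<psi> (0, 1))"
    if "\<psi> \<in> cochains1 pair_scale" for \<psi>
  proof -
    have \<psi>: "\<psi> (x, y) = x * \<psi> (1, 0) + y * \<psi> (0, 1)" for x y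
      using that linear_form_pair by (auto simp: cochains1_def)
    show ?thesis
      \<comment> \<open>This instance gives the value 0 at the zero bracket. Expansion of the form
        is limited to arguments \<open>(0, _ + _)\<close>, the shape of the values of
        \<open>m0_pmap\<close>, since the general equation would rewrite its own right-hand side
        forever.\<close>
      using \<psi>[of 0 0]
      by (auto simp: restr_diff1_def diff1_def ind1_def m0_bracket_def m0_pmap_def pair_scale_def
          ebar1_def ebar2_def fun_eq_iff zero_prod_def \<psi>[of 0 "_ + _"] algebra_simps)
  qed
  \<comment> \<open>The multiple c of the coordinate form dual to e_2 takes the value c at e_2, so
    every c occurs.\<close>
  have 2: "(\<lambda>g. c * snd g) \<in> cochains1 pair_scale" for c :: 'a
    by (auto simp: cochains1_def linear_form_iff[OF vector_space_pair_scale] pair_scale_def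
        algebra_simps)
  show ?thesis
  proof
    show "?B \<subseteq> range ?r" by (auto simp: restr_coboundaries2_def 1)
    show "range ?r \<subseteq> ?B"
    proof
      fix x assume "x \<in> range ?r"
      then obtain c where "x = ?r c" by blast
      then have "x = restr_diff1 m0_bracket (m0_pmap (l\<^sub>1, l\<^sub>2)) (\<lambda>g. c * snd g)"
        using 1[OF 2, of c] by simp
      then show "x \<in> ?B" using 2 by (auto simp: restr_coboundaries2_def)
    qed
  qed
qed

lemma m0_cocycles2_eq:
  fixes l\<^sub>1 l\<^sub>2 :: "'a::field"
  assumes char: "CHAR('a) = 2" and l: "(l\<^sub>1, l\<^sub>2) \<noteq> (0, 0)"
  shows "restr_cocycles2 pair_scale m0_bracket (m0_pmap (l\<^sub>1, l\<^sub>2)) =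
    {((\<lambda>g h. 0), (\<lambda>g. a * ebar1 g + b * ebar2 g)) | a b. True}" (is "?Z = ?P")
proof
  have two: "(2 :: 'a) = 0" using of_nat_CHAR[where 'a = 'a] char by simp
  note lin = linear_form_iff[OF vector_space_pair_scale]
  \<comment> \<open>Squaring is additive because 2 = 0, which is the star property for the zero
    form.\<close>
  show "?P \<subseteq> ?Z"
    using two by (auto simp: restr_cocycles2_def restr_cochains2_def cochains2_def star_property_def
      lin restr_diff2_def diff2_def ind2_def ebar1_def ebar2_def pair_scale_def power2_sum
      algebra_simps power_mult_distrib)
  show "?Z \<subseteq> ?P"
  proof
    fix c assume c: "c \<in> ?Z"
    obtain \<phi> \<omega> where c_eq: "c = (\<phi>, \<omega>)" by (cases c)
    have \<phi>: "\<phi> \<in> cochains2 pair_scale" and star: "star_property pair_scale \<phi> \<omega>"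
      and ind: "\<phi> g (m0_pmap (l\<^sub>1, l\<^sub>2) h) = 0" for g h
      using c by (auto simp: c_eq restr_cocycles2_def restr_cochains2_def restr_diff2_def ind2_def
          dest!: fun_cong simp del: split_paired_All)
    have r: "\<phi> g (x, y) = x * \<phi> g (1, 0) + y * \<phi> g (0, 1)" for g x y
      using \<phi> unfolding cochains2_def by (intro linear_form_pair) blast
    have l: "\<phi> (x, y) h = x * \<phi> (1, 0) h + y * \<phi> (0, 1) h" for h x y
      using \<phi> linear_form_pair[of "\<lambda>g. \<phi> g h"] unfolding cochains2_def by blast
    have alt: "\<phi> g g = 0" for g using \<phi> by (simp add: cochains2_def del: split_paired_All)
    \<comment> \<open>The cocycle condition at (e_1, e_1) and (e_1, e_2), where the second arguments
      have \<open>m0_pmap\<close> values \<open>l\<^sub>1\<close> e_2 and \<open>l\<^sub>2\<close>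
      e_2.\<close>
    have "l\<^sub>1 * \<phi> (1, 0) (0, 1) = 0" "l\<^sub>2 * \<phi> (1, 0) (0, 1) = 0"
      using ind[of "(1, 0)" "(1, 0)"] ind[of "(1, 0)" "(0, 1)"]
        r[of "(1, 0)" 0 l\<^sub>1] r[of "(1, 0)" 0 l\<^sub>2]
      by (simp_all add: m0_pmap_def pair_scale_def)
    then have e12: "\<phi> (1, 0) (0, 1) = 0" using assms(2) by auto
    \<comment> \<open>Polarization: antisymmetry on the basis is recovered from the alternating law
      at e_1 + e_2.\<close>
    have "\<phi> (1, 1) (1, 1) = \<phi> (1, 0) (0, 1) + \<phi> (0, 1) (1, 0)"
      using alt[of "(1, 0)"] alt[of "(0, 1)"] by (simp add: l[of 1 1] r[of _ 1 1])
    with e12 alt have e21: "\<phi> (0, 1) (1, 0) = 0" by simp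
    have \<phi>0: "\<phi> g h = 0" for g h
    proof (cases g; cases h)
      fix x y x' y' assume "g = (x, y)" "h = (x', y')"
      then show ?thesis
        using l[of x y h] r[of "(1, 0)" x' y'] r[of "(0, 1)" x' y'] alt e12 e21 by simp
    qed
    have "\<omega> g = \<omega> (1, 0) * ebar1 g + \<omega> (0, 1) * ebar2 g" for g
    proof (cases g)
      case (Pair x y)
      \<comment> \<open>With zero form, the star property makes \<open>\<omega>\<close> additive and
        homogeneous of degree 2, so its values at e_1 and e_2 determine it.\<close>
      have "\<omega> (pair_scale x (1, 0) + pair_scale y (0, 1)) = x\<^sup>2 * \<omega> (1, 0) + y\<^sup>2 * \<omega> (0, 1)"
        using star by (simp add: star_property_def \<phi>0 del: split_paired_All)
      then show ?thesis by (simp add: Pair pair_scale_def ebar1_def ebar2_def mult.commute)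
    qed
    then have "c = ((\<lambda>g h. 0), (\<lambda>g. \<omega> (1, 0) * ebar1 g + \<omega> (0, 1) * ebar2 g))"
      using \<phi>0 unfolding c_eq prod.inject fun_eq_iff by blast
    then show "c \<in> ?P" by blast
  qed
qed

text \<open>In the plane of cocycles, (\<open>l\<^sub>1\<close>, \<open>l\<^sub>2\<close>) are the
  coordinates of a generator of the coboundaries and (u, w) those of v. The nonzero determinant says
  that the two form a basis of the plane. Both cases of the theorem are instances.\<close>

lemma m0_H2_line:
  fixes l\<^sub>1 l\<^sub>2 u w :: "'a::field"
  assumes char: "CHAR('a) = 2" and det: "l\<^sub>1 * w - l\<^sub>2 * u \<noteq> 0"
  defines "v \<equiv> ((\<lambda>g h. 0), (\<lambda>g. u * ebar1 g + w * ebar2 g))"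
  shows "vectorspace.basis class_ring (m0_H2 (l\<^sub>1, l\<^sub>2)) {m0_class2 (l\<^sub>1, l\<^sub>2) v}"
    and "vectorspace.dim class_ring (m0_H2 (l\<^sub>1, l\<^sub>2)) = 1"
proof -
  let ?B = "restr_coboundaries2 pair_scale m0_bracket (m0_pmap (l\<^sub>1, l\<^sub>2))"
  let ?Z = "(restr_cochains2 pair_scale)
    \<lparr>carrier := restr_cocycles2 pair_scale m0_bracket (m0_pmap (l\<^sub>1, l\<^sub>2))\<rparr>"
  interpret C: vectorspace class_ring "restr_cochains2 (pair_scale :: 'a \<Rightarrow> _)"
    by (rule restr_cochains2_vectorspace[OF vector_space_pair_scale])
  have Z: "vectorspace class_ring ?Z"
    by (intro vectorspace.intro C.submodule_is_module class_field
        restr_cocycles2_subspace vector_space_pair_scale)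
  have "(l\<^sub>1, l\<^sub>2) \<noteq> (0, 0)" using det by auto
  note cocycles = m0_cocycles2_eq[OF char this]
  have vZ: "v \<in> carrier ?Z" by (auto simp: cocycles v_def)
  have vB: "v \<notin> ?B"
  proof
    assume "v \<in> ?B"
    then obtain c where "u * ebar1 g + w * ebar2 g = c * (l\<^sub>1 * ebar1 g + l\<^sub>2 * ebar2 g)" for g
      unfolding v_def m0_coboundaries2_eq image_iff prod.inject fun_eq_iff by blast
    \<comment> \<open>Evaluation at e_1 and e_2 reads off the coordinates; proportional vectors
      would make the determinant zero.\<close>
    from this[of "(1, 0)"] this[of "(0, 1)"] have "u = c * l\<^sub>1" "w = c * l\<^sub>2"
      by (simp_all add: ebar1_def ebar2_def)
    with det show False by simp
  qed
  have gen: "\<exists>a\<in>carrier class_ring. \<exists>n\<in>?B. x = n \<oplus>\<^bsub>?Z\<^esub> a \<odot>\<^bsub>?Z\<^esub> v"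
    if "x \<in> carrier ?Z" for x
  proof -
    from that obtain a b where x: "x = ((\<lambda>g h. 0), (\<lambda>g. a * ebar1 g + b * ebar2 g))"
      by (auto simp: cocycles)
    \<comment> \<open>Cramer's rule for writing (a, b) as c times (\<open>l\<^sub>1\<close>,
      \<open>l\<^sub>2\<close>) plus d times (u, w). The two equations are checked after
      multiplication by \<open>D\<close>, which cancels the denominators.\<close>
    define D where "D = l\<^sub>1 * w - l\<^sub>2 * u"
    define c where "c = (a * w - b * u) / D"
    define d where "d = (l\<^sub>1 * b - l\<^sub>2 * a) / D"
    have D: "D \<noteq> 0" using det by (simp add: D_def)
    have "D * (c * l\<^sub>1 + d * u) = D * a" "D * (c * l\<^sub>2 + d * w) = D * b"
      using D by (simp_all add: c_def d_def distrib_left) (simp_all add: D_def algebra_simps)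
    then have "c * l\<^sub>1 + d * u = a" "c * l\<^sub>2 + d * w = b"
      using D by simp_all
    then have "x = ((\<lambda>g h. 0), (\<lambda>g. c * (l\<^sub>1 * ebar1 g + l\<^sub>2 * ebar2 g))) \<oplus>\<^bsub>?Z\<^esub> d \<odot>\<^bsub>?Z\<^esub> v"
      by (auto simp: x v_def restr_cochains2_def fun_eq_iff algebra_simps)
    then show ?thesis by (auto simp: m0_coboundaries2_eq)
  qed
  \<comment> \<open>\<open>restr_class2\<close> forms the coset in the space of all cochains;
    restricting the carrier to cocycles leaves the addition, hence the coset, unchanged.\<close>
  have "m0_class2 (l\<^sub>1, l\<^sub>2) v = ?B +>\<^bsub>?Z\<^esub> v"
    by (simp add: restr_class2_def a_r_coset_def')
  with quotient_module_line[OF Z m0_coboundaries2_subspace[OF char] vZ vB gen]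
  show "vectorspace.basis class_ring (m0_H2 (l\<^sub>1, l\<^sub>2)) {m0_class2 (l\<^sub>1, l\<^sub>2) v}"
    and "vectorspace.dim class_ring (m0_H2 (l\<^sub>1, l\<^sub>2)) = 1"
    by (simp_all add: restr_H2_def)
qed

theorem theorem4p4:
  fixes l\<^sub>1 l\<^sub>2 :: "'a::field"
  assumes "CHAR('a) = 2"
    and "(l\<^sub>1, l\<^sub>2) \<noteq> (0, 0)"
  shows "vectorspace.dim class_ring (m0_H2 (l\<^sub>1, l\<^sub>2)) = 1 \<and>
    (l\<^sub>2 \<noteq> 0 \<longrightarrow>
      vectorspace.basis class_ring (m0_H2 (l\<^sub>1, l\<^sub>2)) {m0_class2 (l\<^sub>1, l\<^sub>2) ((\<lambda>g h. 0), ebar1)}) \<and>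
    (l\<^sub>2 = 0 \<longrightarrow>
      vectorspace.basis class_ring (m0_H2 (l\<^sub>1, l\<^sub>2)) {m0_class2 (l\<^sub>1, l\<^sub>2) ((\<lambda>g h. 0), ebar2)})"
proof (cases "l\<^sub>2 = 0")
  case True
  \<comment> \<open>Here (u, w) = (0, 1), so v is the pair with \<open>ebar2\<close> and the
    determinant is \<open>l\<^sub>1\<close>.\<close>
  with assms(2) have "l\<^sub>1 * 1 - l\<^sub>2 * 0 \<noteq> 0" by simp
  from m0_H2_line[OF assms(1) this] True show ?thesis by simp
next
  case False
  \<comment> \<open>Here (u, w) = (1, 0), so v is the pair with \<open>ebar1\<close> and the
    determinant is -\<open>l\<^sub>2\<close>.\<close>
  then have "l\<^sub>1 * 0 - l\<^sub>2 * 1 \<noteq> 0" by simp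
  from m0_H2_line[OF assms(1) this] False show ?thesis by simp
qed

end
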